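(* Let $r\in[0,+\infty)$ and let $b>a>0$ be real numbers. Then $$C_r(a,b)^2+C_{-r}(a,b)^2<a^2+b^2,$$ where $C_r(a,b)$ denotes the generalized inverse harmonic mean of $a$ and $b$.
   Context: For positive real numbers $a,b$ and real $r\neq 1$, the generalized inverse harmonic mean is $$C_r(a,b)=\Big(\frac{b^r+a^r}{b+a}\Big)^{\frac{1}{r-1}},$$ and $C_1(a,b)$ is defined as the limit as $r\to 1$: $C_1(a,b)=\big(b^b a^a\big)^{\frac{1}{a+b}}$. *)

theory Defs
  imports Complex_Main
begin

text \<open>Meaningful for positive \<open>a\<close>, \<open>b\<close> only. The value at \<open>r = 1\<close> is the limit as \<open>r\<close> tends to 1;
  see \<open>gen_inv_harmonic_mean_tendsto\<close> below.\<close>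

definition gen_inv_harmonic_mean :: "real \<Rightarrow> real \<Rightarrow> real \<Rightarrow> real" where
  "gen_inv_harmonic_mean r a b =
     (if r = 1 then (b powr b * a powr a) powr (1 / (a + b))
      else ((b powr r + a powr r) / (b + a)) powr (1 / (r - 1)))"

lemma gen_inv_harmonic_mean_tendsto:
  fixes a b :: real
  assumes "a > 0" "b > 0"
  shows "((\<lambda>r. gen_inv_harmonic_mean r a b) \<longlongrightarrow> gen_inv_harmonic_mean 1 a b) (at 1)"
proof -
  define g where "g = (\<lambda>r. ln ((b powr r + a powr r) / (b + a)))"
  define L where "L = (b * ln b + a * ln a) / (b + a)"
  have "(g has_real_derivative L) (at 1)"
    unfolding g_def L_def using assms
    by (auto intro!: derivative_eq_intros simp: add_pos_pos)
  then have "((\<lambda>r. (g r - g 1) / (r - 1)) \<longlongrightarrow> L) (at 1)"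
    by (simp add: has_field_derivative_iff)
  moreover have "g 1 = 0"
    using assms by (simp add: g_def)
  ultimately have "((\<lambda>r. exp (g r / (r - 1))) \<longlongrightarrow> exp L) (at 1)"
    by (auto intro: tendsto_exp)
  moreover have "\<forall>\<^sub>F r in at 1. exp (g r / (r - 1)) = gen_inv_harmonic_mean r a b"
  proof -
    have "exp (g r / (r - 1)) = gen_inv_harmonic_mean r a b" if "r \<noteq> 1" for r
    proof -
      have "b powr r + a powr r > 0"
        using assms by (simp add: add_pos_pos)
      then show ?thesis
        using that assms by (simp add: gen_inv_harmonic_mean_def g_def powr_def [of "_ / _"])
    qed
    then show ?thesis
      by (auto simp: eventually_at_filter)
  qed
  moreover have "exp L = gen_inv_harmonic_mean 1 a b"
  proof -
    have "ln (b powr b * a powr a) = b * ln b + a * ln a"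
      using assms by (simp add: ln_mult)
    then show ?thesis
      using assms
      by (simp add: gen_inv_harmonic_mean_def L_def powr_def [of "_ * _"] add.commute)
  qed
  ultimately show ?thesis
    by (simp add: tendsto_cong)
qed

end

theory Submission
  imports Defs
begin

text \<open>
  Put \<open>z = a / b\<close>, \<open>q = z powr r\<close> and \<open>Q = (1 + q) / (1 + z)\<close>. Dividing by \<open>b\<^sup>2\<close>, the claim becomes
  \<open>Q powr (2 / (r - 1)) + (q / Q) powr (2 / (r + 1)) < 1 + z\<^sup>2\<close>.

  For \<open>r > 1\<close> the two powers are \<open>exp (- \<alpha>)\<close> and \<open>z\<^sup>2 * exp \<beta>\<close> with \<open>0 < \<alpha> \<le> \<beta>\<close>. As
  \<open>(1 - exp (- x)) / x\<close> decreases, \<open>z\<^sup>2 * \<beta> * exp \<beta> < \<alpha>\<close> suffices; bounding one exponential by its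
  tangent and the logarithms by rational functions turns this into a polynomial inequality in \<open>z\<close>, \<open>q\<close>.

  For \<open>r < 1\<close> put \<open>c = (1 + z)\<^sup>2 / (4 * z)\<close>, which is \<open>(cosh t)\<^sup>2\<close> for \<open>z = exp (- 2 * t)\<close>. The bound
  \<open>ln (cosh (r * t)) \<ge> r\<^sup>2 * ln (cosh t)\<close> estimates the sum by \<open>z * (c powr (1 + r) + c powr (1 - r))\<close>,
  which is good enough when \<open>c powr r\<close> is not large. Otherwise \<open>z\<close> and \<open>q\<close> are small, and crude
  estimates suffice.
\<close>

section \<open>Elementary bounds for \<open>ln\<close> and \<open>exp\<close>\<close>

lemma ln_ge_Pade:
  fixes x :: real
  assumes "1 \<le> x"
  shows "2 * (x - 1) / (x + 1) \<le> ln x"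
proof -
  define f where "f = (\<lambda>x::real. ln x - 2 * (x - 1) / (x + 1))"
  have "f 1 \<le> f x"
  proof (rule DERIV_nonneg_imp_nondecreasing[OF assms])
    fix y :: real assume y: "1 \<le> y" "y \<le> x"
    have "(f has_real_derivative (y - 1)\<^sup>2 / (y * (y + 1)\<^sup>2)) (at y)"
      unfolding f_def using y
      apply (auto intro!: derivative_eq_intros)
      apply (simp add: divide_simps power2_eq_square)
      apply (simp add: algebra_simps)
      done
    moreover have "0 \<le> (y - 1)\<^sup>2 / (y * (y + 1)\<^sup>2)"
      using y by simp
    ultimately show "\<exists>d. (f has_real_derivative d) (at y) \<and> 0 \<le> d"
      by blast
  qed
  then show ?thesis by (simp add: f_def)
qed

text \<open>The substitution \<open>x = exp s\<close> turns this into
  \<open>s \<le> sinh s\<close>.\<close>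

lemma ln_le_sinh_form:
  fixes x :: real
  assumes "1 \<le> x"
  shows "ln x \<le> (x - 1 / x) / 2"
proof -
  define f where "f = (\<lambda>x::real. (x - 1 / x) / 2 - ln x)"
  have "f 1 \<le> f x"
  proof (rule DERIV_nonneg_imp_nondecreasing[OF assms])
    fix y :: real assume y: "1 \<le> y" "y \<le> x"
    have "(f has_real_derivative (y - 1)\<^sup>2 / (2 * y\<^sup>2)) (at y)"
      unfolding f_def using y
      apply (auto intro!: derivative_eq_intros)
      apply (simp add: divide_simps power2_eq_square)
      apply (simp add: algebra_simps)
      done
    moreover have "0 \<le> (y - 1)\<^sup>2 / (2 * y\<^sup>2)"
      using y by simp
    ultimately show "\<exists>d. (f has_real_derivative d) (at y) \<and> 0 \<le> d"
      by blast
  qed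
  then show ?thesis by (simp add: f_def)
qed

text \<open>The derivative has the sign of \<open>exp (- u) * (1 + u) - 1\<close>, which is
  nonpositive by the tangent bound for \<open>exp\<close>.\<close>

lemma one_minus_exp_div_antimono:
  fixes x y :: real
  assumes "0 < x" "x \<le> y"
  shows "(1 - exp (- y)) / y \<le> (1 - exp (- x)) / x"
proof -
  define f where "f = (\<lambda>x::real. (1 - exp (- x)) / x)"
  have "f y \<le> f x"
  proof (rule DERIV_nonpos_imp_nonincreasing[OF assms(2)])
    fix u :: real assume u: "x \<le> u" "u \<le> y"
    have pos: "0 < u" using u assms by simp
    have "(f has_real_derivative (exp (- u) * (1 + u) - 1) / u\<^sup>2) (at u)"
      unfolding f_def using pos
      apply (auto intro!: derivative_eq_intros)
      apply (simp add: divide_simps power2_eq_square)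
      apply (simp add: algebra_simps)
      done
    moreover have "exp (- u) * (1 + u) \<le> exp (- u) * exp u"
      by (intro mult_left_mono) (auto simp: exp_ge_add_one_self)
    then have "exp (- u) * (1 + u) \<le> 1"
      by (simp flip: exp_add)
    then have "(exp (- u) * (1 + u) - 1) / u\<^sup>2 \<le> 0"
      by (simp add: divide_nonpos_nonneg)
    ultimately show "\<exists>d. (f has_real_derivative d) (at u) \<and> d \<le> 0"
      by blast
  qed
  then show ?thesis by (simp add: f_def)
qed

section \<open>Hyperbolic functions at \<open>t\<close> and \<open>r * t\<close>\<close>

lemma tanh_mult_ge:
  fixes r t :: real
  assumes "0 \<le> r" "r \<le> 1" "0 \<le> t"
  shows "r * tanh t \<le> tanh (r * t)"
proof -
  define f where "f = (\<lambda>t::real. tanh (r * t) - r * tanh t)"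
  have "f 0 \<le> f t"
  proof (rule DERIV_nonneg_imp_nondecreasing[OF assms(3)])
    fix u :: real assume u: "0 \<le> u" "u \<le> t"
    have "(f has_real_derivative r * ((tanh u)\<^sup>2 - (tanh (r * u))\<^sup>2)) (at u)"
      unfolding f_def
      by (auto intro!: derivative_eq_intros) (simp add: algebra_simps)
    moreover have "r * u \<le> u" using u assms by (simp add: mult_left_le_one_le)
    then have "(tanh (r * u))\<^sup>2 \<le> (tanh u)\<^sup>2"
      using u assms by (intro power_mono) auto
    then have "0 \<le> r * ((tanh u)\<^sup>2 - (tanh (r * u))\<^sup>2)"
      using assms by simp
    ultimately show "\<exists>d. (f has_real_derivative d) (at u) \<and> 0 \<le> d"
      by blast
  qed
  then show ?thesis by (simp add: f_def)
qed

text \<open>The difference vanishes at 0, and its derivative is \<open>r\<close> times the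
  difference that \<open>tanh_mult_ge\<close> shows to be nonnegative.\<close>

lemma ln_cosh_mult_ge:
  fixes r t :: real
  assumes "0 \<le> r" "r \<le> 1" "0 \<le> t"
  shows "r\<^sup>2 * ln (cosh t) \<le> ln (cosh (r * t))"
proof -
  define f where "f = (\<lambda>t::real. ln (cosh (r * t)) - r\<^sup>2 * ln (cosh t))"
  have "f 0 \<le> f t"
  proof (rule DERIV_nonneg_imp_nondecreasing[OF assms(3)])
    fix u :: real assume u: "0 \<le> u" "u \<le> t"
    have "(f has_real_derivative r * (tanh (r * u) - r * tanh u)) (at u)"
      unfolding f_def
      by (auto intro!: derivative_eq_intros simp: cosh_real_pos)
        (simp add: tanh_def algebra_simps power2_eq_square)
    moreover have "0 \<le> r * (tanh (r * u) - r * tanh u)"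
      using tanh_mult_ge[of r u] u assms by simp
    ultimately show "\<exists>d. (f has_real_derivative d) (at u) \<and> 0 \<le> d"
      by blast
  qed
  then show ?thesis by (simp add: f_def)
qed

lemma cosh_half_ln_eq:
  fixes z :: real
  assumes "0 < z"
  shows "ln (cosh (- ln z / 2)) = ln (1 + z) - ln z / 2 - ln 2"
proof -
  have "cosh (- ln z / 2) = (1 + z) / (2 * exp (ln z / 2))"
  proof -
    have "exp (ln z / 2) * exp (ln z / 2) = z"
      using assms by (simp flip: exp_add)
    then show ?thesis
      by (simp add: cosh_def exp_minus divide_simps)
  qed
  then show ?thesis
    using assms by (simp add: ln_div ln_mult)
qed

text \<open>Twice \<open>ln_cosh_mult_ge\<close> at \<open>t = - ln z / 2\<close>: passing from
  \<open>z\<close> to \<open>z powr r\<close> multiplies \<open>t\<close> by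
  \<open>r\<close>.\<close>

lemma ln_one_plus_powr_ge:
  fixes z r :: real
  assumes "0 \<le> r" "r \<le> 1" "0 < z" "z \<le> 1"
  shows "r\<^sup>2 * (2 * ln (1 + z) - ln z - 2 * ln 2) \<le> 2 * ln (1 + z powr r) - r * ln z - 2 * ln 2"
proof -
  have "r * (- ln z / 2) = - ln (z powr r) / 2"
    using assms by (simp add: ln_powr)
  then have *: "ln (cosh (r * (- ln z / 2))) = ln (1 + z powr r) - r * ln z / 2 - ln 2"
    using cosh_half_ln_eq[of "z powr r"] assms by (simp add: ln_powr)
  have "r\<^sup>2 * ln (cosh (- ln z / 2)) \<le> ln (cosh (r * (- ln z / 2)))"
    using assms by (intro ln_cosh_mult_ge) auto
  then show ?thesis
    unfolding * cosh_half_ln_eq[OF \<open>0 < z\<close>] by (simp add: algebra_simps)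
qed

section \<open>The case \<open>r > 1\<close>\<close>

text \<open>This is the numerator that remains in \<open>ln_ratio_inequality\<close> once the
  logarithms are replaced by rational functions. The rearrangement isolates \<open>1 - z\<close> and
  \<open>z - q\<close>, so that each summand has an evident sign.\<close>

lemma key_polynomial_pos:
  fixes z q :: real
  assumes "0 < q" "q < z" "z < 1"
  shows "0 < (z\<^sup>2 - 2 * q - 3 * q * z) * (z + q) * (2 + z + q) + 8 * z * q * (2 - z + 3 * q)"
proof -
  have "(z\<^sup>2 - 2 * q - 3 * q * z) * (z + q) * (2 + z + q) + 8 * z * q * (2 - z + 3 * q)
      = (1 - z) * (4 * q * (3 * z - q)) + (1 - z) * (2 * z\<^sup>2 * (z - q) + 2 * q\<^sup>2 * (5 * z - q))
        + z * ((z - q) * (3 * z\<^sup>2 + 5 * q\<^sup>2))"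
    by (simp add: algebra_simps power2_eq_square)
  moreover have "0 < (1 - z) * (4 * q * (3 * z - q))" using assms by simp
  moreover have "0 \<le> (1 - z) * (2 * z\<^sup>2 * (z - q) + 2 * q\<^sup>2 * (5 * z - q))"
    using assms by (intro mult_nonneg_nonneg add_nonneg_nonneg) auto
  moreover have "0 \<le> z * ((z - q) * (3 * z\<^sup>2 + 5 * q\<^sup>2))"
    using assms by (intro mult_nonneg_nonneg add_nonneg_nonneg) auto
  ultimately show ?thesis by linarith
qed

text \<open>Squaring absorbs the factor 2; after clearing denominators the difference factors as
  \<open>(z - q) * (1 - z * q)\<close>.\<close>

lemma two_ln_ratio_le:
  fixes z q :: real
  assumes "0 < q" "q < z" "z < 1"
  shows "2 * ln ((1 + z) / (1 + q)) \<le> ln (z / q)"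
proof -
  have "(1 + q)\<^sup>2 * z - (1 + z)\<^sup>2 * q = (z - q) * (1 - z * q)"
    by (simp add: power2_eq_square algebra_simps)
  moreover have "z * q \<le> 1" using assms by (intro mult_le_one) auto
  ultimately have "(1 + z)\<^sup>2 * q \<le> (1 + q)\<^sup>2 * z"
    using assms by (smt (verit) mult_nonneg_nonneg)
  then have "((1 + z) / (1 + q))\<^sup>2 \<le> z / q"
    using assms by (simp add: power_divide divide_simps mult.commute)
  then have "ln (((1 + z) / (1 + q))\<^sup>2) \<le> ln (z / q)"
    using assms by (intro ln_mono) auto
  then show ?thesis using assms by (simp add: ln_realpow)
qed

text \<open>This is what the case \<open>r > 1\<close> comes down to after linearising an
  exponential; \<open>r\<close> enters only through \<open>q\<close>. Replacing \<mu> by its Pade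
  lower bound \<open>m\<close>, and then \<open>D\<close> by its upper bound, only lowers the
  right-hand side, and leaves a rational inequality.\<close>

lemma ln_ratio_inequality:
  fixes z q :: real
  assumes "0 < q" "q < z" "z < 1"
  defines "\<mu> \<equiv> ln ((1 + z) / (1 + q))" and "D \<equiv> ln (z / q)"
  shows "z < \<mu> * (1 + z) + 2 / D * (\<mu> * (1 - \<mu>))"
proof -
  define m where "m = 2 * (z - q) / (2 + z + q)"
  have Dpos: "0 < D" using assms by (simp add: D_def)
  have D_le: "D \<le> (z\<^sup>2 - q\<^sup>2) / (2 * z * q)"
    using ln_le_sinh_form[of "z / q"] assms
    by (simp add: D_def divide_simps power2_eq_square algebra_simps)
  have m_eq: "2 * ((1 + z) / (1 + q) - 1) / ((1 + z) / (1 + q) + 1) = m"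
    using assms by (simp add: m_def divide_simps)
  have m_le: "m \<le> \<mu>"
    using ln_ge_Pade[of "(1 + z) / (1 + q)"] assms unfolding m_eq by (simp add: \<mu>_def)
  have m01: "0 < m" "m < 1" using assms by (auto simp: m_def)
  have mu_le: "\<mu> \<le> 1"
  proof -
    have "\<mu> \<le> ln (1 + z)" using assms by (simp add: \<mu>_def ln_div)
    also have "\<dots> \<le> z" using assms by (intro ln_add_one_self_le_self) simp
    finally show ?thesis using assms by simp
  qed
  have mu_D: "2 * \<mu> \<le> D"
    using two_ln_ratio_le[of q z] assms by (simp add: \<mu>_def D_def)
  \<comment> \<open>The right-hand side at \<mu> minus its value at \<open>m\<close>, factored. The
    bound \<open>2 * \<mu> \<le> D\<close> keeps the second factor nonnegative.\<close>
  have "0 \<le> (\<mu> - m) * ((1 + z) + 2 / D * (1 - \<mu> - m))"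
  proof (intro mult_nonneg_nonneg)
    have "2 * (\<mu> + m - 1) \<le> D" using mu_D m_le mu_le by simp
    then have "- 1 \<le> 2 / D * (1 - \<mu> - m)"
      using Dpos by (simp add: divide_simps)
    then show "0 \<le> (1 + z) + 2 / D * (1 - \<mu> - m)" using assms by simp
  qed (use m_le in simp)
  then have "m * (1 + z) + 2 / D * (m * (1 - m)) \<le> \<mu> * (1 + z) + 2 / D * (\<mu> * (1 - \<mu>))"
    by (simp add: algebra_simps add_divide_distrib diff_divide_distrib)
  moreover have "4 * z * q / (z\<^sup>2 - q\<^sup>2) * (m * (1 - m)) \<le> 2 / D * (m * (1 - m))"
  proof (intro mult_right_mono)
    have "0 < z\<^sup>2 - q\<^sup>2" using assms by (simp add: power_strict_mono)
    then show "4 * z * q / (z\<^sup>2 - q\<^sup>2) \<le> 2 / D"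
      using D_le Dpos assms by (simp add: divide_simps mult.commute mult.left_commute)
  qed (use m01 in simp)
  moreover have "z < m * (1 + z) + 4 * z * q / (z\<^sup>2 - q\<^sup>2) * (m * (1 - m))"
  proof -
    have sq: "z\<^sup>2 - q\<^sup>2 = (z - q) * (z + q)" by (simp add: power2_eq_square algebra_simps)
    have "m * (1 + z) + 4 * z * q / (z\<^sup>2 - q\<^sup>2) * (m * (1 - m)) - z
       = ((z\<^sup>2 - 2 * q - 3 * q * z) * (z + q) * (2 + z + q) + 8 * z * q * (2 - z + 3 * q))
         / ((z + q) * (2 + z + q)\<^sup>2)"
    proof -
      have m1: "1 - m = (2 - z + 3 * q) / (2 + z + q)"
        using assms by (simp add: m_def divide_simps)
      have "4 * z * q / (z\<^sup>2 - q\<^sup>2) * (m * (1 - m))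
          = 8 * z * q * (2 - z + 3 * q) / ((z + q) * (2 + z + q)\<^sup>2)"
        unfolding m1 sq unfolding m_def using assms by (simp add: divide_simps power2_eq_square)
      moreover have "m * (1 + z) - z = (z\<^sup>2 - 2 * q - 3 * q * z) / (2 + z + q)"
        unfolding m_def using assms by (simp add: divide_simps power2_eq_square) (simp add: algebra_simps)
      moreover have "\<dots> = (z\<^sup>2 - 2 * q - 3 * q * z) * (z + q) * (2 + z + q) / ((z + q) * (2 + z + q)\<^sup>2)"
        using assms by (simp add: divide_simps power2_eq_square)
      ultimately show ?thesis by (simp add: add_divide_distrib)
    qed
    moreover have "0 < \<dots>" using key_polynomial_pos[of q z] assms by (intro divide_pos_pos) auto
    ultimately show ?thesis by linarith
  qed
  ultimately show ?thesis by linarith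
qed

lemma normalized_bound_gt_one:
  fixes z r :: real
  assumes "1 < r" "0 < z" "z < 1"
  defines "q \<equiv> z powr r"
  shows "((1 + q) / (1 + z)) powr (2 / (r - 1)) + (q * (1 + z) / (1 + q)) powr (2 / (r + 1)) < 1 + z\<^sup>2"
proof -
  define l where "l = - ln z"
  define \<mu> where "\<mu> = ln ((1 + z) / (1 + q))"
  define D where "D = (r - 1) * l"
  define \<alpha> where "\<alpha> = 2 * \<mu> / (r - 1)"
  define \<beta> where "\<beta> = 2 * (l + \<mu>) / (r + 1)"
  \<comment> \<open>Chosen so that \<open>\<beta> = l + \<mu> - y\<close> and
    \<open>\<beta> * \<mu> = \<alpha> * y\<close>; these identities eliminate \<beta> in
    \<open>zb\<close>.\<close>
  define y where "y = (r - 1) / (r + 1) * (l + \<mu>)"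
  have lpos: "0 < l" using assms by (simp add: l_def)
  have qpos: "0 < q" using assms by (simp add: q_def)
  have lnq: "ln q = - r * l" using assms by (simp add: q_def l_def ln_powr)
  have qz: "q < z"
    using powr_less_mono'[of z 1 r] assms by (simp add: q_def)
  have mupos: "0 < \<mu>" using qz qpos by (simp add: \<mu>_def)
  have Dpos: "0 < D" using lpos assms by (simp add: D_def)
  have Dln: "D = ln (z / q)"
    using qpos assms lnq by (simp add: D_def ln_div l_def algebra_simps)
  have main: "z < \<mu> * (1 + z) + 2 / D * (\<mu> * (1 - \<mu>))"
    using ln_ratio_inequality[OF qpos qz \<open>z < 1\<close>] by (simp add: \<mu>_def Dln)
  have lz: "l * z \<le> 1 - z"
  proof -
    have "ln (1 / z) \<le> 1 / z - 1" using assms by (intro ln_le_minus_one) simp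
    then have "l \<le> 1 / z - 1" using assms by (simp add: l_def ln_div)
    then show ?thesis using assms by (simp add: field_simps)
  qed
  \<comment> \<open>Multiplying \<open>main\<close> by \<open>D * l\<close> and weakening it by
    \<open>lz\<close> gives exactly this inequality times \<open>D + 2 * l\<close>.\<close>
  have yi: "y * z < \<mu> * (1 + y - \<mu>)"
  proof -
    have "D * l * z < D * l * (\<mu> * (1 + z) + 2 / D * (\<mu> * (1 - \<mu>)))"
      using main Dpos lpos by (intro mult_strict_left_mono) auto
    also have "\<dots> = D * \<mu> * (l + l * z) + 2 * l * (\<mu> * (1 - \<mu>))"
      using Dpos by (simp add: field_simps)
    also have "\<dots> \<le> D * \<mu> * (l + (1 - z)) + 2 * l * (\<mu> * (1 - \<mu>))"
      using lz Dpos mupos by (intro add_right_mono mult_left_mono) auto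
    finally have G: "D * l * z < D * \<mu> * (l + (1 - z)) + 2 * l * (\<mu> * (1 - \<mu>))" .
    have y_eq: "y * (D + 2 * l) = D * (l + \<mu>)"
    proof -
      have "D + 2 * l = (r + 1) * l" by (simp add: D_def algebra_simps)
      then show ?thesis using assms by (simp add: y_def D_def)
    qed
    have "(D + 2 * l) * (\<mu> * (1 + y - \<mu>) - y * z)
        = (D + 2 * l) * (\<mu> * (1 - \<mu>)) + y * (D + 2 * l) * (\<mu> - z)"
      by (simp add: algebra_simps)
    also have "\<dots> = D * \<mu> * (l + (1 - z)) + 2 * l * (\<mu> * (1 - \<mu>)) - D * l * z"
      unfolding y_eq by (simp add: algebra_simps)
    also have "\<dots> > 0" using G by simp
    finally show ?thesis using Dpos lpos by (simp add: zero_less_mult_iff)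
  qed
  have apos: "0 < \<alpha>" using mupos assms by (simp add: \<alpha>_def)
  have bpos: "0 < \<beta>" using mupos lpos assms by (simp add: \<beta>_def)
  have b_eq: "\<beta> = l + \<mu> - y"
    using assms by (simp add: \<beta>_def y_def divide_simps) (simp add: algebra_simps)
  have ba: "\<beta> * \<mu> = \<alpha> * y"
    using assms by (simp add: \<beta>_def y_def \<alpha>_def)
  have expl: "exp l = 1 / z" using assms by (simp add: l_def exp_minus inverse_eq_divide)
  \<comment> \<open>Multiplied by \<open>\<mu> / \<alpha>\<close>, this reads
    \<open>z * y * exp (\<mu> - y) < \<mu>\<close>, which follows from \<open>yi\<close> and
    \<open>1 + y - \<mu> \<le> exp (y - \<mu>)\<close>.\<close>
  have zb: "z\<^sup>2 * (\<beta> * exp \<beta>) < \<alpha>"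
  proof -
    have "z * y < \<mu> * exp (y - \<mu>)"
    proof -
      have "\<mu> * (1 + y - \<mu>) \<le> \<mu> * exp (y - \<mu>)"
        using mupos exp_ge_add_one_self[of "y - \<mu>"] by (intro mult_left_mono) (auto simp: algebra_simps)
      then show ?thesis using yi by (simp add: mult.commute)
    qed
    then have "z * y * exp (\<mu> - y) < \<mu> * exp (y - \<mu>) * exp (\<mu> - y)"
      by (intro mult_strict_right_mono) auto
    then have "z * y * exp (\<mu> - y) < \<mu>" by (simp add: mult.assoc flip: exp_add)
    then have "\<alpha> * (z * y * exp (\<mu> - y)) < \<alpha> * \<mu>" using apos by simp
    moreover have "exp \<beta> = exp (\<mu> - y) / z"
    proof -
      have "exp \<beta> = exp l * exp (\<mu> - y)" by (simp add: b_eq flip: exp_add)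
      then show ?thesis by (simp add: expl)
    qed
    then have "z\<^sup>2 * (\<beta> * exp \<beta>) * \<mu> = \<alpha> * (z * y * exp (\<mu> - y))"
      using ba assms by (simp add: power2_eq_square mult.commute mult.left_commute)
    ultimately show ?thesis using mupos by (metis mult_less_cancel_right_pos)
  qed
  have ab: "\<alpha> \<le> \<beta>"
  proof -
    have "2 * \<mu> \<le> D"
      unfolding Dln \<mu>_def using qpos qz assms(3) by (intro two_ln_ratio_le) auto
    then show ?thesis using assms by (simp add: \<alpha>_def \<beta>_def D_def divide_simps) (simp add: algebra_simps)
  qed
  \<comment> \<open>First \<open>zb\<close> trades the prefactor for \<alpha>, then monotonicity
    trades \<beta> for \<alpha> in the quotient.\<close>
  have "z\<^sup>2 * (exp \<beta> - 1) = z\<^sup>2 * (\<beta> * exp \<beta>) * ((1 - exp (- \<beta>)) / \<beta>)"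
    using bpos by (simp add: exp_minus field_simps)
  also have "\<dots> < \<alpha> * ((1 - exp (- \<beta>)) / \<beta>)"
    using zb bpos by (intro mult_strict_right_mono) auto
  also have "\<dots> \<le> \<alpha> * ((1 - exp (- \<alpha>)) / \<alpha>)"
    using one_minus_exp_div_antimono[OF apos ab] apos by (intro mult_left_mono) auto
  also have "\<dots> = 1 - exp (- \<alpha>)" using apos by simp
  finally have fin: "exp (- \<alpha>) + z\<^sup>2 * exp \<beta> < 1 + z\<^sup>2" by (simp add: algebra_simps)
  have X: "((1 + q) / (1 + z)) powr (2 / (r - 1)) = exp (- \<alpha>)"
    using qpos assms(1-3) by (simp add: powr_def \<alpha>_def \<mu>_def ln_div divide_simps)
  have Y: "(q * (1 + z) / (1 + q)) powr (2 / (r + 1)) = z\<^sup>2 * exp \<beta>"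
  proof -
    have "ln (q * (1 + z) / (1 + q)) = - r * l + \<mu>"
      using qpos assms(1-3) lnq by (simp add: ln_div ln_mult \<mu>_def)
    moreover have "2 / (r + 1) * (- r * l + \<mu>) = \<beta> - 2 * l"
      using assms by (simp add: \<beta>_def divide_simps) (simp add: algebra_simps)
    moreover have "exp (\<beta> - 2 * l) = z\<^sup>2 * exp \<beta>"
    proof -
      have "exp (- 2 * l) = z\<^sup>2"
        using assms by (simp add: l_def exp_double)
      then show ?thesis by (simp add: exp_diff exp_minus field_simps)
    qed
    moreover have "q * (1 + z) / (1 + q) \<noteq> 0" using qpos assms(2) by simp
    ultimately show ?thesis unfolding powr_def by metis
  qed
  show ?thesis using fin by (simp add: X Y)
qed

section \<open>The case \<open>r = 1\<close>\<close>

text \<open>The exponential is the limit of the first power as \<open>r\<close> tends to 1; the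
  second power is \<open>z\<close> because \<open>q = z\<close>. The Pade bound at
  \<open>1 / z\<close> and a tangent bound for \<open>exp\<close> reduce the claim to
  \<open>0 < 3 * z * (1 - z)^3\<close>.\<close>

lemma normalized_bound_one:
  fixes z :: real
  assumes "0 < z" "z < 1"
  shows "exp (2 * z * ln z / (1 + z)) + z < 1 + z\<^sup>2"
proof -
  define x where "x = - 2 * z * ln z / (1 + z)"
  have p: "0 < (1 + z)\<^sup>2 + 4 * z * (1 - z)" using assms by (intro add_pos_pos) auto
  have "2 * (1 - z) / (1 + z) \<le> - ln z"
    using ln_ge_Pade[of "1 / z"] assms by (simp add: ln_div divide_simps)
  then have "2 * z / (1 + z) * (2 * (1 - z) / (1 + z)) \<le> 2 * z / (1 + z) * (- ln z)"
    using assms by (intro mult_left_mono) auto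
  then have x: "4 * z * (1 - z) / (1 + z)\<^sup>2 \<le> x"
    by (simp add: x_def power2_eq_square algebra_simps)
  have "((1 + z)\<^sup>2 + 4 * z * (1 - z)) / (1 + z)\<^sup>2 = 1 + 4 * z * (1 - z) / (1 + z)\<^sup>2"
    using assms by (simp add: add_divide_distrib)
  also have "\<dots> \<le> exp x" using x exp_ge_add_one_self[of x] by linarith
  finally have "((1 + z)\<^sup>2 + 4 * z * (1 - z)) / (1 + z)\<^sup>2 \<le> exp x" .
  then have "exp (- x) \<le> (1 + z)\<^sup>2 / ((1 + z)\<^sup>2 + 4 * z * (1 - z))"
    using p assms by (simp add: exp_minus field_simps)
  also have "\<dots> < 1 - z + z\<^sup>2"
  proof -
    have "(1 - z + z\<^sup>2) * ((1 + z)\<^sup>2 + 4 * z * (1 - z)) - (1 + z)\<^sup>2 = 3 * z * (1 - z)^3"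
      by (simp add: power2_eq_square power3_eq_cube algebra_simps)
    moreover have "0 < 3 * z * (1 - z)^3" using assms by simp
    ultimately have "(1 + z)\<^sup>2 < (1 - z + z\<^sup>2) * ((1 + z)\<^sup>2 + 4 * z * (1 - z))" by linarith
    then show ?thesis using p by (simp add: pos_divide_less_eq)
  qed
  finally show ?thesis by (simp add: x_def)
qed

section \<open>The case \<open>r < 1\<close>\<close>

text \<open>With \<open>x = c powr r\<close> the sum is at most \<open>z * c * (x + 1 / x)\<close>,
  while \<open>4 * z * c = (1 + z)\<^sup>2\<close> gives
  \<open>1 + z\<^sup>2 = z * c * (4 - 2 / c)\<close>. It remains to compare the last
  factors.\<close>

lemma normalized_bound_lt_one_moderate:
  fixes z r :: real
  assumes "0 \<le> r" "r < 1" "0 < z" "z < 1"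
  defines "q \<equiv> z powr r" and "c \<equiv> (1 + z)\<^sup>2 / (4 * z)"
  assumes c_le: "c powr r \<le> 5 / 2"
  shows "((1 + q) / (1 + z)) powr (2 / (r - 1)) + (q * (1 + z) / (1 + q)) powr (2 / (r + 1)) < 1 + z\<^sup>2"
proof -
  have qpos: "0 < q" using assms by (simp add: q_def)
  have lnq: "ln q = r * ln z" using assms by (simp add: q_def ln_powr)
  have c1: "1 < c"
  proof -
    have "0 < (1 - z)\<^sup>2" using assms by simp
    then have "4 * z < (1 + z)\<^sup>2" by (simp add: power2_eq_square algebra_simps)
    then show ?thesis using assms by (simp add: c_def)
  qed
  define x where "x = c powr r"
  have x1: "1 \<le> x" using c1 assms by (simp add: x_def ge_one_powr_ge_zero)
  have xc: "x \<le> c" using powr_mono[of r 1 c] c1 assms by (simp add: x_def)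
  have lnc: "ln c = 2 * ln (1 + z) - ln z - 2 * ln 2"
  proof -
    have "ln (4::real) = 2 * ln 2" using ln_realpow[of "2::real" 2] by simp
    then show ?thesis using assms by (simp add: c_def ln_div ln_mult ln_realpow)
  qed
  \<comment> \<open>Dividing by \<open>1 - r\<close> yields \<open>X\<close>; adding
    \<open>2 * r * ln z\<close> and dividing by \<open>1 + r\<close> yields
    \<open>Y\<close>.\<close>
  have key: "2 * (ln (1 + z) - ln (1 + q)) \<le> (1 - r\<^sup>2) * ln c + (1 - r) * ln z"
    using ln_one_plus_powr_ge[OF assms(1) less_imp_le[OF assms(2)] assms(3) less_imp_le[OF assms(4)]]
    unfolding lnc q_def by (simp add: algebra_simps)
  have X: "((1 + q) / (1 + z)) powr (2 / (r - 1)) \<le> c powr (1 + r) * z"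
  proof -
    have "2 / (r - 1) * ln ((1 + q) / (1 + z)) = 2 * (ln (1 + z) - ln (1 + q)) / (1 - r)"
      using qpos assms(1-4) by (simp add: ln_div divide_simps) (simp add: algebra_simps)
    also have "\<dots> \<le> ((1 - r\<^sup>2) * ln c + (1 - r) * ln z) / (1 - r)"
      using key assms by (intro divide_right_mono) auto
    also have "\<dots> = (1 + r) * ln c + ln z"
      using assms by (simp add: divide_simps) (simp add: algebra_simps power2_eq_square)
    finally have "exp (2 / (r - 1) * ln ((1 + q) / (1 + z))) \<le> exp ((1 + r) * ln c + ln z)" by simp
    then show ?thesis using qpos assms c1 by (simp add: powr_def exp_add)
  qed
  have Y: "(q * (1 + z) / (1 + q)) powr (2 / (r + 1)) \<le> c powr (1 - r) * z"
  proof -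
    have "2 / (r + 1) * ln (q * (1 + z) / (1 + q)) = (2 * (ln (1 + z) - ln (1 + q)) + 2 * r * ln z) / (1 + r)"
      using qpos assms(1-4) lnq by (simp add: ln_div ln_mult divide_simps) (simp add: algebra_simps)
    also have "\<dots> \<le> ((1 - r\<^sup>2) * ln c + (1 - r) * ln z + 2 * r * ln z) / (1 + r)"
      using key assms by (intro divide_right_mono) auto
    also have "\<dots> = (1 - r) * ln c + ln z"
      using assms by (simp add: divide_simps) (simp add: algebra_simps power2_eq_square)
    finally have "exp (2 / (r + 1) * ln (q * (1 + z) / (1 + q))) \<le> exp ((1 - r) * ln c + ln z)" by simp
    then show ?thesis using qpos assms c1 by (simp add: powr_def exp_add)
  qed
  have "x + 1 / x < 4 - 2 / c"
  \<comment> \<open>\<open>x + 1 / x\<close> increases for \<open>x \<ge> 1\<close>. For small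
    \<open>c\<close> use \<open>x \<le> c\<close>, which leaves the gap
    \<open>(c - 1) * (3 - c) / c\<close>. For large \<open>c\<close> the hypothesis
    \<open>x \<le> 5 / 2\<close> gives at most 29/10, below \<open>4 - 4 / 5\<close>.\<close>
  proof (cases "c \<le> 5 / 2")
    case True
    have "x + 1 / x \<le> c + 1 / c"
    proof -
      have "c + 1 / c - (x + 1 / x) = (c - x) * (c * x - 1) / (c * x)"
        using x1 c1 by (simp add: divide_simps) (simp add: algebra_simps)
      moreover have "1 \<le> c * x" using x1 c1 mult_mono[of 1 c 1 x] by simp
      ultimately show ?thesis using xc x1 c1
        by (smt (verit) divide_nonneg_nonneg mult_nonneg_nonneg)
    qed
    moreover have "c + 1 / c < 4 - 2 / c"
    proof -
      have "0 < (c - 1) * (3 - c)" using True c1 by simp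
      then have "0 < (c - 1) * (3 - c) / c" using c1 by simp
      also have "\<dots> = 4 - 2 / c - (c + 1 / c)" using c1 by (simp add: field_simps)
      finally show ?thesis by simp
    qed
    ultimately show ?thesis by linarith
  next
    case False
    have "x + 1 / x \<le> 29 / 10"
    proof -
      have "0 \<le> (5 / 2 - x) * (x - 2 / 5)" using x1 c_le by (simp add: x_def)
      then show ?thesis using x1 by (simp add: field_simps)
    qed
    moreover have "2 / c < 4 / 5" using False by (simp add: field_simps)
    ultimately show ?thesis by linarith
  qed
  then have "z * c * (x + 1 / x) < z * c * (4 - 2 / c)"
    using assms c1 by (intro mult_strict_left_mono) auto
  also have "\<dots> = 4 * (z * c) - 2 * z" using c1 by (simp add: field_simps)
  also have "\<dots> = 1 + z\<^sup>2"
    using assms(3) by (simp add: c_def) (simp add: power2_eq_square algebra_simps)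
  finally have "c powr (1 + r) * z + c powr (1 - r) * z < 1 + z\<^sup>2"
    using c1 by (simp add: powr_add powr_diff x_def algebra_simps)
  then show ?thesis using X Y by linarith
qed

text \<open>The hypothesis forces \<open>z < 16 / 125\<close> and \<open>q < 2 / 5\<close>, and then
  the sum is even below 1. The second power is at most its base \<open>g\<close>. For the first,
  \<open>X1\<close> serves when \<open>q\<close> is well above \<open>z\<close>, and
  \<open>X2\<close> when they are comparable.\<close>

lemma normalized_bound_lt_one_extreme:
  fixes z r :: real
  assumes "0 \<le> r" "r < 1" "0 < z" "z < 1"
  defines "q \<equiv> z powr r" and "c \<equiv> (1 + z)\<^sup>2 / (4 * z)"
  assumes c_ge: "5 / 2 < c powr r"
  shows "((1 + q) / (1 + z)) powr (2 / (r - 1)) + (q * (1 + z) / (1 + q)) powr (2 / (r + 1)) < 1 + z\<^sup>2"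
proof -
  define Q where "Q = (1 + q) / (1 + z)"
  have qpos: "0 < q" using assms by (simp add: q_def)
  have lnq: "ln q = r * ln z" using assms by (simp add: q_def ln_powr)
  have c1: "1 \<le> c"
  proof -
    have "0 \<le> (1 - z)\<^sup>2" by simp
    then have "4 * z \<le> (1 + z)\<^sup>2" by (simp add: power2_eq_square algebra_simps)
    then show ?thesis using assms by (simp add: c_def)
  qed
  have "5 / 2 < c" using powr_mono[of r 1 c] c1 assms by simp
  then have "10 * z < (1 + z)\<^sup>2" using assms by (simp add: c_def field_simps)
  then have "0 < z\<^sup>2 - 8 * z + 1" by (simp add: power2_eq_square algebra_simps)
  \<comment> \<open>16/125 lies just above the smaller root \<open>4 - sqrt 15\<close> and below
    \<open>exp (- 2)\<close>, as \<open>X2\<close> requires.\<close>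
  moreover have "z\<^sup>2 - 8 * z + 1 \<le> 0" if "16 / 125 \<le> z"
  proof -
    have "0 \<le> (z - 16 / 125) * (1 - z)" using that assms by simp
    then have "z\<^sup>2 \<le> 141 / 125 * z - 16 / 125" by (simp add: power2_eq_square field_simps)
    then show ?thesis using that by linarith
  qed
  ultimately have z_le: "z < 16 / 125" by force
  have q_le: "q < 2 / 5"
  proof -
    have "(1 + z)\<^sup>2 \<le> 2\<^sup>2" using assms by (intro power_mono) auto
    then have "c \<le> 1 / z" using assms by (simp add: c_def divide_simps)
    then have "c powr r \<le> (1 / z) powr r" using c1 assms by (intro powr_mono2) auto
    also have "\<dots> = 1 / q" using assms by (simp add: q_def powr_divide)
    finally have "c powr r \<le> 1 / q" .
    with c_ge have "5 / 2 < 1 / q" by linarith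
    then show ?thesis using qpos by (simp add: field_simps)
  qed
  have zq: "z < q"
    using powr_less_mono'[of z r 1] assms by (simp add: q_def)
  have Q1: "1 < Q" using zq assms by (simp add: Q_def)
  define g where "g = q * (1 + z) / (1 + q)"
  have g01: "0 < g" "g \<le> 1"
  proof -
    have "q * z \<le> 1" using assms q_le qpos by (intro mult_le_one) auto
    then show "0 < g" "g \<le> 1" using assms(1-4) qpos by (auto simp: g_def divide_simps algebra_simps add_pos_pos)
  qed
  have Y: "g powr (2 / (r + 1)) \<le> g"
    using powr_mono'[of 1 "2 / (r + 1)" g] g01 assms by simp
  have X1: "Q powr (2 / (r - 1)) \<le> ((1 + z) / (1 + q))\<^sup>2"
  proof -
    have "2 / (r - 1) \<le> - 2" using assms by (simp add: field_simps)
    then have "Q powr (2 / (r - 1)) \<le> Q powr (- 2)" using Q1 by (intro powr_mono) auto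
    also have "\<dots> = ((1 + z) / (1 + q))\<^sup>2"
    proof -
      have "Q powr (- 2) = (1 / Q)\<^sup>2" using Q1 by (simp add: powr_minus power_divide inverse_eq_divide)
      then show ?thesis by (simp add: Q_def)
    qed
    finally show ?thesis .
  qed
  have X2: "Q powr (2 / (r - 1)) \<le> (1 + z) / (1 + 5 * z)"
  proof -
    define d where "d = - (1 - r) * ln z"
    \<comment> \<open>\<open>Q = (1 + z * exp d) / (1 + z)\<close> is a weighted mean of
      \<open>exp\<close> at 0 and \<open>d\<close>, and \<open>m\<close> is the same mean of the
      points. Convexity gives \<open>exp m \<le> Q\<close>; \<open>e1\<close> and \<open>e2\<close>
      are the tangent bounds at \<open>m\<close>.\<close>
    define m where "m = z * d / (1 + z)"
    have qd: "q = z * exp d"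
    proof -
      have "z * exp d = exp (ln z + d)" using assms(3) by (simp add: exp_add)
      also have "ln z + d = r * ln z" by (simp add: d_def algebra_simps)
      finally show ?thesis using assms(3) by (simp add: q_def powr_def)
    qed
    have e1: "exp m * (1 - m) \<le> 1"
    proof -
      have "exp m * (1 - m) \<le> exp m * exp (- m)"
        using exp_ge_add_one_self[of "- m"] by (intro mult_left_mono) auto
      then show ?thesis by (simp flip: exp_add)
    qed
    have e2: "exp m * (1 + d - m) \<le> exp d"
    proof -
      have "exp m * (1 + d - m) \<le> exp m * exp (d - m)"
        using exp_ge_add_one_self[of "d - m"] by (intro mult_left_mono) (auto simp: algebra_simps)
      then show ?thesis by (simp flip: exp_add)
    qed
    have "exp m * (1 + z) = exp m * (1 - m) + z * (exp m * (1 + d - m))"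
    proof -
      have "exp m * (1 - m) + z * (exp m * (1 + d - m)) = exp m * (1 + z) + exp m * (z * d - m * (1 + z))"
        by (simp add: algebra_simps)
      moreover have "z * d = m * (1 + z)" using assms by (simp add: m_def)
      ultimately show ?thesis by simp
    qed
    also have "\<dots> \<le> 1 + z * exp d"
      using e1 e2 assms by (intro add_mono mult_left_mono) auto
    finally have "exp m \<le> Q" using assms qd by (simp add: Q_def field_simps)
    then have "m \<le> ln Q" using Q1 by (simp add: ln_ge_iff)
    then have "2 / (r - 1) * ln Q \<le> 2 / (r - 1) * m"
      using assms by (intro mult_left_mono_neg) (auto simp: divide_nonneg_neg)
    \<comment> \<open>The factor \<open>1 - r\<close> in \<open>d\<close> cancels, leaving the
      exponent of the case \<open>r = 1\<close>.\<close>
    also have "\<dots> = 2 * z * ln z / (1 + z)"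
      using assms by (simp add: m_def d_def divide_simps)
    also have "\<dots> \<le> - (4 * z / (1 + z))"
    proof -
      have "exp (2::real) \<le> 125 / 16"
      proof -
        \<comment> \<open>At 1/32 the quadratic bound for \<open>exp\<close> is sharp enough to
          survive the 64th power.\<close>
        have "exp (2::real) = exp (1 / 32) ^ 64" by (simp flip: exp_of_nat_mult)
        also have "\<dots> \<le> (1 + 1 / 32 + (1 / 32)\<^sup>2) ^ 64"
          by (intro power_mono exp_bound) auto
        also have "\<dots> \<le> 125 / 16" by (simp add: power2_eq_square power_divide divide_simps)
        finally show ?thesis .
      qed
      then have "16 / 125 \<le> exp (- 2 :: real)" by (simp add: exp_minus field_simps)
      then have "z \<le> exp (- 2)" using z_le by linarith
      then have "ln z \<le> - 2" using assms by (metis ln_exp ln_mono)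
      then have "2 * z * ln z \<le> 2 * z * (- 2)" using assms by (intro mult_left_mono) auto
      then show ?thesis using assms by (simp add: divide_simps)
    qed
    finally have "Q powr (2 / (r - 1)) \<le> exp (- (4 * z / (1 + z)))"
      using Q1 by (simp add: powr_def)
    also have "\<dots> \<le> 1 / (1 + 4 * z / (1 + z))"
    proof -
      have "0 < 1 + 4 * z / (1 + z)" using assms by (simp add: add_pos_pos)
      then show ?thesis using exp_ge_add_one_self[of "4 * z / (1 + z)"]
        by (simp add: exp_minus field_simps)
    qed
    also have "\<dots> = (1 + z) / (1 + 5 * z)" using assms by (simp add: field_simps)
    finally show ?thesis .
  qed
  have "Q powr (2 / (r - 1)) + g < 1"
  \<comment> \<open>The first branch works once \<open>q / z\<close> exceeds
    \<open>2 + 16 / 125 + 2 / 5 + 4 / 25 = 2.688\<close>, the second as long as it stays below about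
    2.98.\<close>
  proof (cases "269 / 100 * z \<le> q")
    case True
    have "q * z \<le> 2 / 5 * z" "z * z \<le> 16 / 125 * z" using q_le z_le assms by (intro mult_right_mono; simp)+
    moreover have "q * q * z \<le> 2 / 5 * (2 / 5) * z"
      using q_le qpos assms by (intro mult_right_mono mult_mono) auto
    ultimately have "2 * z + z * z + q * z + q * q * z < q" using True assms by linarith
    then have "(1 + z)\<^sup>2 + q * (1 + z) * (1 + q) < (1 + q)\<^sup>2"
      by (simp add: power2_eq_square algebra_simps)
    then have "((1 + z)\<^sup>2 + q * (1 + z) * (1 + q)) / (1 + q)\<^sup>2 < 1"
      using qpos by simp
    moreover have "((1 + z)\<^sup>2 + q * (1 + z) * (1 + q)) / (1 + q)\<^sup>2 = ((1 + z) / (1 + q))\<^sup>2 + g"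
    proof -
      have "q * (1 + z) * (1 + q) / (1 + q)\<^sup>2 = g" using qpos by (simp add: g_def power2_eq_square)
      then show ?thesis by (simp only: add_divide_distrib[of "(1 + z)\<^sup>2"] power_divide)
    qed
    ultimately show ?thesis using X1 by linarith
  next
    case False
    have "q * (1 + 2 * z + 5 * z * z) \<le> q * (1 + 2 * (16 / 125) + 5 * (16 / 125) * (16 / 125))"
      using z_le assms qpos by (intro mult_left_mono add_mono mult_mono) auto
    also have "\<dots> < 4 * z" using False assms by (simp add: not_le)
    finally have "q * (1 + z) * (1 + 5 * z) < 4 * z * (1 + q)" by (simp add: algebra_simps)
    then have "g < 4 * z / (1 + 5 * z)" using assms(3) qpos by (simp add: g_def field_simps)
    moreover have "(1 + z) / (1 + 5 * z) + 4 * z / (1 + 5 * z) = 1"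
      using assms by (simp flip: add_divide_distrib)
    ultimately show ?thesis using X2 by linarith
  qed
  moreover have "0 \<le> z\<^sup>2" by simp
  ultimately show ?thesis using Y unfolding Q_def g_def by linarith
qed

section \<open>Normalization by \<open>b\<close> and the theorem\<close>

text \<open>Homogeneity: the factor \<open>b powr (r - 1)\<close> of the quotient becomes
  \<open>b\<close> under the power \<open>1 / (r - 1)\<close>.\<close>

lemma gen_inv_harmonic_mean_sq:
  fixes r a b :: real
  assumes "r \<noteq> 1" "0 < a" "0 < b"
  shows "(gen_inv_harmonic_mean r a b)\<^sup>2
    = b\<^sup>2 * ((1 + (a / b) powr r) / (1 + a / b)) powr (2 / (r - 1))"
proof -
  define Q where "Q = (1 + (a / b) powr r) / (1 + a / b)"
  have "0 < Q" using assms by (simp add: Q_def add_pos_nonneg add_pos_pos)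
  moreover have "(b powr r + a powr r) / (b + a) = b powr (r - 1) * Q"
    using assms by (simp add: Q_def powr_divide powr_diff divide_simps)
  ultimately have "gen_inv_harmonic_mean r a b = (b powr (r - 1)) powr (1 / (r - 1)) * Q powr (1 / (r - 1))"
    using assms by (simp add: gen_inv_harmonic_mean_def powr_mult)
  also have "(b powr (r - 1)) powr (1 / (r - 1)) = b"
    using assms by (simp add: powr_powr)
  finally show ?thesis
    by (simp add: Q_def power_mult_distrib power2_eq_square flip: powr_add)
qed

theorem theorem4p2:
  fixes r a b :: real
  assumes "r \<ge> 0" and "0 < a" and "a < b"
  shows "(gen_inv_harmonic_mean r a b)\<^sup>2 + (gen_inv_harmonic_mean (- r) a b)\<^sup>2 < a\<^sup>2 + b\<^sup>2"
proof -
  define z where "z = a / b"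
  define q where "q = z powr r"
  have z: "0 < z" "z < 1" and b: "0 < b" using assms by (auto simp: z_def)
  have qpos: "0 < q" using z by (simp add: q_def)
  \<comment> \<open>At \<open>- r\<close> both the base and the exponent are inverted in form: the
    base is \<open>1 / g\<close> and the exponent is negative, so a positive power of
    \<open>g\<close> remains.\<close>
  have neg: "(gen_inv_harmonic_mean (- r) a b)\<^sup>2 = b\<^sup>2 * (q * (1 + z) / (1 + q)) powr (2 / (r + 1))"
  proof -
    define g where "g = q * (1 + z) / (1 + q)"
    have "(1 + z powr (- r)) / (1 + z) = 1 / g"
      using z qpos by (simp add: g_def powr_minus q_def field_simps)
    moreover have "2 / (- r - 1) = - (2 / (r + 1))"
      using assms by (simp add: field_simps)
    moreover have "(1 / g) powr (- (2 / (r + 1))) = g powr (2 / (r + 1))"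
      using z qpos by (simp add: g_def powr_divide powr_minus)
    ultimately show ?thesis
      using gen_inv_harmonic_mean_sq[of "- r" a b] assms b
      unfolding z_def[symmetric] g_def by simp
  qed
  have ab: "a\<^sup>2 + b\<^sup>2 = b\<^sup>2 * (1 + z\<^sup>2)"
    using b by (simp add: z_def power_divide field_simps)
  show ?thesis
  proof (cases "r = 1")
    case True
    have "ln (gen_inv_harmonic_mean 1 a b) = ln b + z * ln z / (1 + z)"
    proof -
      have "ln (gen_inv_harmonic_mean 1 a b) = (b * ln b + a * ln a) / (a + b)"
        using assms b by (simp add: gen_inv_harmonic_mean_def ln_powr ln_mult)
      also have "\<dots> = ln b + z * ln z / (1 + z)"
        using assms b by (simp add: z_def ln_div divide_simps) (simp add: algebra_simps)
      finally show ?thesis .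
    qed
    moreover have "0 < gen_inv_harmonic_mean 1 a b"
      using assms b by (simp add: gen_inv_harmonic_mean_def)
    ultimately have "gen_inv_harmonic_mean 1 a b = b * exp (z * ln z / (1 + z))"
      using b by (metis exp_add exp_ln)
    then have "(gen_inv_harmonic_mean 1 a b)\<^sup>2 = b\<^sup>2 * exp (2 * z * ln z / (1 + z))"
      by (simp add: power_mult_distrib power2_eq_square flip: exp_add)
    \<comment> \<open>Here \<open>q = z\<close>, so the base is \<open>z\<close> and the exponent 1:
      the mean of order -1 is the geometric mean.\<close>
    moreover have "(gen_inv_harmonic_mean (- 1) a b)\<^sup>2 = b\<^sup>2 * z"
      using neg True z by (simp add: q_def)
    ultimately show ?thesis
      using normalized_bound_one[OF z] b True
      by (simp add: ab flip: distrib_left)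
  next
    case False
    \<comment> \<open>The three bounds cover \<open>r > 1\<close> and, for \<open>r < 1\<close>,
      both sides of the threshold 5/2 for \<open>c powr r\<close>.\<close>
    have "((1 + q) / (1 + z)) powr (2 / (r - 1)) + (q * (1 + z) / (1 + q)) powr (2 / (r + 1)) < 1 + z\<^sup>2"
      using normalized_bound_gt_one[of r z] normalized_bound_lt_one_moderate[of r z]
        normalized_bound_lt_one_extreme[of r z] assms False z
      unfolding q_def by linarith
    then show ?thesis
      using gen_inv_harmonic_mean_sq[of r a b] neg assms False b
      by (simp add: ab q_def z_def flip: distrib_left)
  qed
qed

end
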